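(* Let $G=(V,E)$ be an undirected graph. Then $$P^\star_{\mathrm{sub}}(G) = P_{\mathrm{sub}}(G)\cap \left\{ (y,z) \in \mathbb{R}^E \times \mathbb{R}^V \;\middle|\; \sum_{e\in F} y_e \le \sum_{v\in V} z_v - 1 \ \text{ for every spanning forest } F \subseteq E \text{ of } G \right\},$$ where $P_{\mathrm{sub}}(G)$ is the subgraph polytope and $P^\star_{\mathrm{sub}}(G)$ is the non-empty subgraph polytope of $G$.
   Context: Graphs are finite and undirected, with edges written as two-element sets $\{v,w\}$ of nodes. For $S\subseteq V$, $E(S)$ denotes the set of edges of $G$ with both endnodes in $S$, and $\chi(\cdot)$ denotes the characteristic vector (of a subset of $E$ in $\{0,1\}^E$, or of a subset of $V$ in $\{0,1\}^V$). The subgraph polytope of $G$ is $$P_{\mathrm{sub}}(G) := \operatorname{conv}\{(\chi(F),\chi(S)) \in \{0,1\}^E\times\{0,1\}^V \mid F\subseteq E(S),\ S\subseteq V\}.$$ The non-empty subgraph polytope of $G$ is $$P^\star_{\mathrm{sub}}(G) := \operatorname{conv}\{(\chi(F),\chi(S)) \in \{0,1\}^E\times\{0,1\}^V \mid F\subseteq E(S),\ \emptyset\ne S\subseteq V\}.$$ A spanning forest of $G$ is (the edge set $F\subseteq E$ of) a forest in $G$ such that $(V,F)$ has the same connected components (as node sets) as $G$. *)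

theory Defs
  imports "HOL-Analysis.Analysis"
begin

text \<open>
  A finite graph is a node set \<open>V\<close> inside a finite type together with an edge set \<open>E\<close> of
  two-element subsets of \<open>V\<close>. Since \<open>V\<close> need not be the whole type, edgeless graphs and the
  graph without nodes are covered.
\<close>

definition finite_graph :: "'v set \<Rightarrow> 'v set set \<Rightarrow> bool" where
  "finite_graph V E \<longleftrightarrow> finite V \<and> (\<forall>e\<in>E. e \<subseteq> V \<and> card e = 2)"

definition edges_within :: "'v set set \<Rightarrow> 'v set \<Rightarrow> 'v set set" where
  "edges_within E S = {e \<in> E. e \<subseteq> S}"

definition adjacency :: "'v set set \<Rightarrow> ('v \<times> 'v) set" where
  "adjacency E = {(u, v). {u, v} \<in> E}"

definition connected_components :: "'v set \<Rightarrow> 'v set set \<Rightarrow> 'v set set" where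
  "connected_components V E = V // {(u, v). u \<in> V \<and> v \<in> V \<and> (u, v) \<in> (adjacency E)\<^sup>*}"

text \<open>A cycle is given by the list of its distinct nodes in cyclic order.\<close>

definition is_cycle :: "'v set set \<Rightarrow> 'v list \<Rightarrow> bool" where
  "is_cycle E vs \<longleftrightarrow> length vs \<ge> 3 \<and> distinct vs \<and>
     (\<forall>i<length vs. {vs ! i, vs ! ((i + 1) mod length vs)} \<in> E)"

definition spanning_forest :: "'v set \<Rightarrow> 'v set set \<Rightarrow> 'v set set \<Rightarrow> bool" where
  "spanning_forest V E F \<longleftrightarrow> F \<subseteq> E \<and> (\<nexists>vs. is_cycle F vs) \<and>
     connected_components V F = connected_components V E"

definition char_vec :: "'i set \<Rightarrow> real ^ 'i::finite" where
  "char_vec A = (\<chi> i. indicator A i)"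

text \<open>
  \<open>\<real>\<^sup>E \<times> \<real>\<^sup>V\<close> is realised as the coordinate subspace, supported on \<open>E\<close> and \<open>V\<close>, of the
  space with one coordinate for each set of nodes and one for each node of the ambient type.
\<close>

definition edge_node_space ::
    "'v::finite set \<Rightarrow> 'v set set \<Rightarrow> ((real ^ ('v set)) \<times> (real ^ 'v)) set" where
  "edge_node_space V E = {(y, z). (\<forall>e. e \<notin> E \<longrightarrow> y $ e = 0) \<and> (\<forall>v. v \<notin> V \<longrightarrow> z $ v = 0)}"

definition subgraph_polytope ::
    "'v::finite set \<Rightarrow> 'v set set \<Rightarrow> ((real ^ ('v set)) \<times> (real ^ 'v)) set" where
  "subgraph_polytope V E =
     convex hull {(char_vec F, char_vec S) | F S. F \<subseteq> edges_within E S \<and> S \<subseteq> V}"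

definition nonempty_subgraph_polytope ::
    "'v::finite set \<Rightarrow> 'v set set \<Rightarrow> ((real ^ ('v set)) \<times> (real ^ 'v)) set" where
  "nonempty_subgraph_polytope V E =
     convex hull {(char_vec F, char_vec S) | F S. F \<subseteq> edges_within E S \<and> S \<noteq> {} \<and> S \<subseteq> V}"

end

theory Submission imports Defs begin

text \<open>
  Every forest has at most \<open>card S - 1\<close> edges inside a nonempty node set \<open>S\<close>, which gives the
  inclusion from left to right.

  Conversely, let \<open>(y, z)\<close> satisfy the constraints. It lies on a segment from the origin to a point
  of the nonempty subgraph polytope, so \<open>(y, z) = u q\<close> with \<open>u \<le> 1\<close>. Kruskal's algorithm for a
  spanning forest \<open>F\<close> of maximum weight \<open>y\<close> produces nonnegative weights \<open>w\<close> on the nonempty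
  node sets of total \<open>T = z(V) - y(F) \<ge> 1\<close> such that the sets containing a node \<open>v\<close> have weight
  \<open>z\<^sub>v\<close> and those containing an edge \<open>e\<close> have weight at least \<open>y\<^sub>e\<close>: start with weight \<open>z\<^sub>v\<close> on each
  singleton, and whenever an edge \<open>e\<close> joins two components, move weight \<open>y\<^sub>e\<close> from both of them to
  their union. Hence \<open>(y, z) = T q'\<close> with \<open>q'\<close> in the nonempty subgraph polytope, and \<open>(y, z)\<close> lies
  between \<open>q\<close> and \<open>q'\<close>.
\<close>

subsection \<open>Forests\<close>

text \<open>Paths are node lists, as in \<open>is_cycle\<close>, so that a prefix of a path closed
  by one further edge is literally a cycle.\<close>

definition distinct_path :: "'v set set \<Rightarrow> 'v list \<Rightarrow> bool" where
  "distinct_path H vs \<longleftrightarrow> distinct vs \<and> (\<forall>i. Suc i < length vs \<longrightarrow> {vs ! i, vs ! Suc i} \<in> H)"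

lemma is_cycle_mono: "is_cycle F vs \<Longrightarrow> F \<subseteq> H \<Longrightarrow> is_cycle H vs"
  by (auto simp: is_cycle_def)

lemma distinct_path_Cons:
  assumes "distinct_path H vs" "vs \<noteq> []" "{u, hd vs} \<in> H" "u \<notin> set vs"
  shows "distinct_path H (u # vs)"
  using assms by (auto simp: distinct_path_def nth_Cons hd_conv_nth split: nat.splits)

text \<open>The edge from the first node to position \<open>j\<close> closes the prefix ending
  there; \<open>2 \<le> j\<close> supplies the three nodes a cycle must have.\<close>

lemma is_cycle_take_distinct_path:
  assumes "distinct_path H vs" "2 \<le> j" "j < length vs" "{vs ! 0, vs ! j} \<in> H"
  shows "is_cycle H (take (Suc j) vs)"
proof -
  have "{take (Suc j) vs ! i, take (Suc j) vs ! ((i + 1) mod Suc j)} \<in> H" if "i < Suc j" for i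
  proof (cases "i = j")
    case True
    then show ?thesis using assms by (simp add: insert_commute)
  next
    case False
    then show ?thesis using assms that by (simp add: distinct_path_def)
  qed
  then show ?thesis
    using assms by (simp add: is_cycle_def distinct_path_def)
qed

text \<open>The leaf \<open>a\<close> is the first node of a longest path: a neighbour other than
  the second node would lengthen the path or close a cycle.\<close>

lemma forest_has_leaf:
  assumes "finite S" "H \<noteq> {}" "\<forall>e\<in>H. e \<subseteq> S \<and> card e = 2" "\<nexists>vs. is_cycle H vs"
  obtains a b where "a \<noteq> b" "{a, b} \<in> H" "\<And>e. e \<in> H \<Longrightarrow> a \<in> e \<Longrightarrow> e = {a, b}"
proof -
  define P where "P = (\<lambda>vs. distinct_path H vs \<and> 2 \<le> length vs)"
  obtain x y where xy: "{x, y} \<in> H" "x \<noteq> y"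
    using assms(2,3) by (metis card_2_iff ex_in_conv)
  have "P [x, y]"
    using xy by (auto simp: P_def distinct_path_def less_Suc_eq)
  moreover have "length vs \<le> card S" if "P vs" for vs
  proof -
    have "set vs \<subseteq> S"
    proof
      fix u assume "u \<in> set vs"
      then obtain i where i: "i < length vs" "u = vs ! i"
        by (auto simp: in_set_conv_nth)
      show "u \<in> S"
      proof (cases "Suc i < length vs")
        case True
        then have "{vs ! i, vs ! Suc i} \<in> H"
          using that by (simp add: P_def distinct_path_def)
        then show ?thesis using i assms(3) by auto
      next
        case False
        \<comment> \<open>The last node has no successor, but it has a predecessor because the path
          has at least two nodes.\<close>
        then have "{vs ! (i - 1), vs ! i} \<in> H"
          using that i by (auto simp: P_def distinct_path_def dest: spec[of _ "i - 1"])
        then show ?thesis using i assms(3) by auto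
      qed
    qed
    then show ?thesis
      using that by (metis P_def assms(1) card_mono distinct_card distinct_path_def)
  qed
  ultimately obtain vs where vs: "P vs" and longest: "\<And>us. P us \<Longrightarrow> length us \<le> length vs"
    using ex_has_greatest_nat[of P "[x, y]" length "Suc (card S)"]
    by (auto simp: less_Suc_eq_le)
  have path: "distinct_path H vs" and len: "2 \<le> length vs"
    using vs by (auto simp: P_def)
  have hd: "hd vs = vs ! 0" "vs \<noteq> []"
    using len by (cases vs; simp)+
  show thesis
  proof
    show "{vs ! 0, vs ! 1} \<in> H" "vs ! 0 \<noteq> vs ! 1"
      using path len hd nth_eq_iff_index_eq[of vs 0 1]
      by (auto simp: distinct_path_def Suc_le_eq numeral_2_eq_2)
    fix e assume e: "e \<in> H" "vs ! 0 \<in> e"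
    then obtain x y where "e = {x, y}" "x \<noteq> y"
      using assms(3) by (metis card_2_iff)
    with e obtain u where u: "e = {vs ! 0, u}" "u \<noteq> vs ! 0"
      by (cases "vs ! 0 = x") (auto simp: insert_commute)
    have "u \<in> set vs"
    proof (rule ccontr)
      assume "u \<notin> set vs"
      then have "P (u # vs)"
        using distinct_path_Cons[OF path] hd e u len by (simp add: P_def insert_commute)
      then show False using longest by fastforce
    qed
    then obtain j where j: "j < length vs" "u = vs ! j"
      by (auto simp: in_set_conv_nth)
    have "\<not> 2 \<le> j"
      using is_cycle_take_distinct_path[OF path] assms(4) j e u by blast
    then have "j = 1"
      using u j by (cases j) auto
    then show "e = {vs ! 0, vs ! 1}" using u j by simp
  qed
qed

text \<open>Pruning a leaf removes one node and exactly one edge, and the neighbour of the leaf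
  keeps the node set nonempty for the induction.\<close>

lemma forest_card_edges_less:
  assumes "finite S" "S \<noteq> {}" "\<forall>e\<in>H. e \<subseteq> S \<and> card e = 2" "\<nexists>vs. is_cycle H vs"
  shows "card H < card S"
  using assms
proof (induction "card S" arbitrary: S H rule: less_induct)
  case less
  show ?case
  proof (cases "H = {}")
    case True
    then show ?thesis using less.prems(1,2) by (simp add: card_gt_0_iff)
  next
    case False
    from forest_has_leaf[OF less.prems(1) False less.prems(3,4)]
    obtain a b where ab: "a \<noteq> b" "{a, b} \<in> H" "\<And>e. e \<in> H \<Longrightarrow> a \<in> e \<Longrightarrow> e = {a, b}"
      by blast
    have S: "a \<in> S" "b \<in> S" using ab(2) less.prems(3) by blast+
    have "H \<subseteq> Pow S" using less.prems(3) by blast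
    then have "finite H" using less.prems(1) by (simp add: finite_subset)
    have "card (H - {{a, b}}) < card (S - {a})"
    proof (rule less.hyps)
      show "card (S - {a}) < card S" using S less.prems(1) by (meson card_Diff1_less)
      show "S - {a} \<noteq> {}" using S(2) ab(1) by blast
      show "\<forall>e\<in>H - {{a, b}}. e \<subseteq> S - {a} \<and> card e = 2"
        using ab(3) less.prems(3) by blast
      show "\<nexists>vs. is_cycle (H - {{a, b}}) vs"
        using less.prems(4) is_cycle_mono[of "H - {{a, b}}" _ H] by blast
    qed (simp add: less.prems(1))
    then show ?thesis
      using S(1) ab(2) \<open>finite H\<close> less.prems(1) by (simp add: card_Diff_singleton)
  qed
qed

text \<open>A cycle that is not already in \<open>F\<close> runs through the new edge, and the rest
  of the cycle joins its ends within \<open>F\<close>. The direction of traversal is unknown, hence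
  the disjunction.\<close>

lemma is_cycle_insert_edge:
  assumes "is_cycle (insert {a, b} F) vs" "\<not> is_cycle F vs"
  shows "(a, b) \<in> (adjacency F)\<^sup>* \<or> (b, a) \<in> (adjacency F)\<^sup>*"
proof -
  define n where "n = length vs"
  \<comment> \<open>Reading positions modulo \<open>n\<close> lets a walk continue past the end of
    the list.\<close>
  define v where "v = (\<lambda>i. vs ! (i mod n))"
  have n: "3 \<le> n" and "distinct vs"
    using assms(1) by (auto simp: is_cycle_def n_def)
  have v_eq: "v i = v j \<longleftrightarrow> i mod n = j mod n" for i j
  proof -
    have "i mod n < length vs" "j mod n < length vs" using n by (simp_all flip: n_def)
    then show ?thesis
      using \<open>distinct vs\<close> by (simp add: v_def nth_eq_iff_index_eq)
  qed
  have edge: "{v j, v (Suc j)} \<in> insert {a, b} F" for j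
  proof -
    have "j mod n < n" using n by simp
    then have "{vs ! (j mod n), vs ! ((j mod n + 1) mod n)} \<in> insert {a, b} F"
      using assms(1) unfolding is_cycle_def n_def by blast
    then show ?thesis by (simp add: v_def mod_Suc_eq)
  qed
  obtain i where i: "i < n" "{v i, v (Suc i)} = {a, b}"
    using assms by (auto simp: is_cycle_def n_def v_def)
  \<comment> \<open>The walk leaves the new edge at its second end; after \<open>n - 1\<close> steps
    it arrives at the first end.\<close>
  have "(v (Suc i), v (Suc (i + k))) \<in> (adjacency F)\<^sup>*" if "k < n" for k
    using that
  proof (induction k)
    case (Suc k)
    have no_wrap: "(i + d) mod n \<noteq> i mod n" if "0 < d" "d < n" for d
    proof
      assume "(i + d) mod n = i mod n"
      then have "n dvd d" by (simp add: mod_eq_dvd_iff_nat)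
      then show False using that by (simp add: nat_dvd_not_less)
    qed
    \<comment> \<open>The walk never reuses the new edge. It could only do so backwards or forwards
      from \<open>v (i + 1)\<close>, as \<open>v (i + Suc k)\<close> differs from
      \<open>v i\<close>; then \<open>v (i + 2) = v i\<close>, impossible for
      \<open>n \<ge> 3\<close>.\<close>
    have "{v (Suc (i + k)), v (Suc (Suc (i + k)))} \<noteq> {v i, v (Suc i)}"
    proof
      assume eq: "{v (Suc (i + k)), v (Suc (Suc (i + k)))} = {v i, v (Suc i)}"
      have "v (i + Suc k) \<noteq> v i" 
        using no_wrap[of "Suc k"] Suc.prems v_eq by blast
      then have *: "v (i + Suc (Suc k)) = v i"
        using eq by (auto simp: doubleton_eq_iff)
      then have "v (i + Suc k) = v (i + 1)"
        using eq by (auto simp: doubleton_eq_iff)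
      then have "v (i + Suc (Suc k)) = v (i + 2)"
        by (simp add: v_eq mod_Suc_eq) (metis mod_Suc_eq)
      then show False using * no_wrap[of 2] n v_eq by auto
    qed
    then have "{v (Suc (i + k)), v (Suc (Suc (i + k)))} \<in> F"
      using edge[of "Suc (i + k)"] i by auto
    then show ?case
      using Suc by (auto simp: adjacency_def intro: rtrancl_into_rtrancl)
  qed simp
  from this[of "n - 1"] have "(v (Suc i), v (i + n)) \<in> (adjacency F)\<^sup>*"
    using n by simp
  moreover have "v (i + n) = v i" by (simp add: v_eq)
  ultimately show ?thesis using i(2) by (auto simp: doubleton_eq_iff)
qed

subsection \<open>Connectivity\<close>

abbreviation component :: "'v set set \<Rightarrow> 'v \<Rightarrow> 'v set" where
  "component F v \<equiv> (adjacency F)\<^sup>* `` {v}"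

lemma sym_adjacency_rtrancl: "sym ((adjacency F)\<^sup>*)"
  by (rule sym_rtrancl) (auto simp: sym_def adjacency_def insert_commute)

lemma adjacency_insert: "adjacency (insert {a, b} F) = insert (a, b) (insert (b, a) (adjacency F))"
  by (auto simp: adjacency_def doubleton_eq_iff)

lemma adjacency_rtrancl_sym: "(u, v) \<in> (adjacency F)\<^sup>* \<Longrightarrow> (v, u) \<in> (adjacency F)\<^sup>*"
  using sym_adjacency_rtrancl by (rule symD)

lemma adjacency_rtrancl_iff_component:
  "(u, v) \<in> (adjacency F)\<^sup>* \<longleftrightarrow> component F u = component F v"
proof
  assume uv: "(u, v) \<in> (adjacency F)\<^sup>*"
  show "component F u = component F v"
    using rtrancl_trans[OF uv] rtrancl_trans[OF adjacency_rtrancl_sym[OF uv]] by blast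
qed blast

lemma component_disjoint:
  assumes "(u, v) \<notin> (adjacency F)\<^sup>*"
  shows "component F u \<inter> component F v = {}"
proof (rule ccontr)
  assume "component F u \<inter> component F v \<noteq> {}"
  then obtain x where "(u, x) \<in> (adjacency F)\<^sup>*" "(v, x) \<in> (adjacency F)\<^sup>*" by blast
  then show False
    using assms by (simp add: adjacency_rtrancl_iff_component)
qed

lemma component_subset:
  assumes "\<forall>e\<in>F. e \<subseteq> V" "v \<in> V"
  shows "component F v \<subseteq> V"
proof
  fix u assume "u \<in> component F v"
  then have "(v, u) \<in> (adjacency F)\<^sup>*" by simp
  then show "u \<in> V"
    by induction (use assms in \<open>auto simp: adjacency_def\<close>)
qed

lemma adjacency_rtrancl_insert_iff:
  "(u, v) \<in> (adjacency (insert {a, b} F))\<^sup>* \<longleftrightarrow>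
    (u, v) \<in> (adjacency F)\<^sup>* \<or>
    u \<in> component F a \<union> component F b \<and> v \<in> component F a \<union> component F b"
  \<comment> \<open>Both directions of the new edge are added in turn. With reachability written as
    equality of components, only reasoning about equalities remains.\<close>
  unfolding adjacency_insert rtrancl_insert Un_iff mem_Collect_eq prod.case Image_singleton_iff
    adjacency_rtrancl_iff_component
  by argo

lemma component_insert:
  "component (insert {a, b} F) v =
    (if v \<in> component F a \<union> component F b then component F a \<union> component F b else component F v)"
  unfolding set_eq_iff Image_singleton_iff adjacency_rtrancl_insert_iff
  by (auto intro: rtrancl_trans)

lemma rtrancl_adjacency_insert_cong:
  "(adjacency F)\<^sup>* = (adjacency H)\<^sup>* \<Longrightarrow>
    (adjacency (insert {a, b} F))\<^sup>* = (adjacency (insert {a, b} H))\<^sup>*"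
  by (simp add: adjacency_insert rtrancl_insert)

lemma connected_components_cong:
  "(adjacency F)\<^sup>* = (adjacency H)\<^sup>* \<Longrightarrow> connected_components V F = connected_components V H"
  by (simp add: connected_components_def)

subsection \<open>Kruskal's algorithm\<close>

text \<open>This is the bookkeeping of one merge in Kruskal's algorithm: the node, edge and total
  conditions are all sums over some family \<open>X\<close>.\<close>

lemma sum_move_weight:
  fixes w :: "'a::finite \<Rightarrow> real"
  shows "(\<Sum>S\<in>X. w S + c * (of_bool (S = U) - of_bool (S = A) - of_bool (S = B)))
    = sum w X + c * (of_bool (U \<in> X) - of_bool (A \<in> X) - of_bool (B \<in> X))"
proof -
  have "(\<Sum>S\<in>X. of_bool (S = Y) :: real) = of_bool (Y \<in> X)" for Y
    by (simp add: of_bool_def)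
  then show ?thesis
    by (simp add: sum.distrib sum_subtractf flip: sum_distrib_left)
qed

text \<open>
  The last condition keeps enough weight on each component to merge it along any edge that has not
  been processed yet.
\<close>

lemma kruskal_weights:
  fixes V :: "'v::finite set" and y :: "'v set \<Rightarrow> real"
  assumes "finite_graph V E"
    and "\<And>e. e \<in> E \<Longrightarrow> 0 \<le> y e" "\<And>v. v \<in> V \<Longrightarrow> 0 \<le> z v"
    and "\<forall>e\<in>E. \<forall>v\<in>e. y e \<le> z v"
    and "H \<subseteq> E"
  shows "\<exists>F w. F \<subseteq> H \<and> (\<nexists>vs. is_cycle F vs) \<and> (adjacency F)\<^sup>* = (adjacency H)\<^sup>* \<and>
    (\<forall>S. 0 \<le> w S) \<and> (\<forall>S. w S \<noteq> 0 \<longrightarrow> S \<noteq> {} \<and> S \<subseteq> V) \<and>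
    (\<forall>v\<in>V. sum w {S. v \<in> S} = z v) \<and> (\<forall>e\<in>H. y e \<le> sum w {S. e \<subseteq> S}) \<and>
    sum w UNIV = sum z V - sum y F \<and>
    (\<forall>e\<in>E - H. \<forall>v\<in>e. (\<forall>h\<in>H. y e \<le> y h) \<longrightarrow> y e \<le> w (component F v))"
  \<comment> \<open>Ranking by \<open>- y e\<close> inserts the edges in order of nonincreasing
    \<open>y\<close>.\<close>
  using finite[of H] \<open>H \<subseteq> E\<close>
proof (induction H rule: finite_ranking_induct[where f = "\<lambda>e. - y e"])
  case empty
  define w where "w = (\<lambda>S. \<Sum>v\<in>V. if S = {v} then z v else 0)"
  have w_single: "w {v} = z v" if "v \<in> V" for v
    using that by (simp add: w_def)
  have "sum w {S. v \<in> S} = z v" if "v \<in> V" for v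
  proof -
    have "sum w {S. v \<in> S} = (\<Sum>u\<in>V. if u = v then z u else 0)"
      unfolding w_def by (subst sum.swap) (auto intro!: sum.cong)
    then show ?thesis using that by simp
  qed
  moreover have "sum w UNIV = sum z V"
    unfolding w_def by (subst sum.swap) simp
  moreover have "S \<noteq> {} \<and> S \<subseteq> V" if "w S \<noteq> 0" for S
  proof -
    have "\<exists>v\<in>V. S = {v}"
    proof (rule ccontr)
      assume "\<not> ?thesis"
      then have "w S = 0" unfolding w_def by (intro sum.neutral) auto
      then show False using that by simp
    qed
    then show ?thesis by auto
  qed
  moreover have "0 \<le> w S" for S
    unfolding w_def by (intro sum_nonneg) (simp add: assms(3))
  moreover have "\<not> is_cycle {} vs" for vs :: "'v list"
    by (auto simp: is_cycle_def intro!: exI[of _ 0])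
  moreover have "y e \<le> w (component {} v)" if "e \<in> E" "v \<in> e" for e v
  proof -
    have "v \<in> V" using that assms(1) by (auto simp: finite_graph_def)
    then show ?thesis using that assms(4) w_single by (simp add: adjacency_def)
  qed
  ultimately show ?case
    by (intro exI[of _ "{}"] exI[of _ w]) simp
next
  case (insert e H)
  have "H \<subseteq> E" using insert.prems by simp
  from insert.IH[OF this] obtain F w where
    F: "F \<subseteq> H" "\<nexists>vs. is_cycle F vs" "(adjacency F)\<^sup>* = (adjacency H)\<^sup>*"
    and w: "\<forall>S. 0 \<le> w S" "\<forall>S. w S \<noteq> 0 \<longrightarrow> S \<noteq> {} \<and> S \<subseteq> V"
      "\<forall>v\<in>V. sum w {S. v \<in> S} = z v" "\<forall>e\<in>H. y e \<le> sum w {S. e \<subseteq> S}"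
      "\<forall>e\<in>E - H. \<forall>v\<in>e. (\<forall>h\<in>H. y e \<le> y h) \<longrightarrow> y e \<le> w (component F v)"
    and w_total: "sum w UNIV = sum z V - sum y F"
    by (elim exE conjE) (rule that; assumption)
  note w_nonneg = w(1)[rule_format] and w_supp = w(2)[rule_format]
    and w_node = w(3)[rule_format] and w_edge = w(4)[rule_format]
  have w_comp: "y e \<le> w (component F v)"
    if "e \<in> E" "e \<notin> H" "v \<in> e" "\<And>h. h \<in> H \<Longrightarrow> y e \<le> y h" for e v
    using w(5) that by blast
  have le: "y e \<le> y h" if "h \<in> H" for h using insert.hyps(2) that by force
  have "e \<in> E" using insert.prems by auto
  then obtain a b where e: "e = {a, b}" "a \<noteq> b" "a \<in> V" "b \<in> V"
    using assms(1) by (auto simp: finite_graph_def card_2_iff)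
  show ?case
  \<comment> \<open>The ranking induction does not exclude that the inserted edge is already
    present.\<close>
  proof (cases "e \<in> H")
    case True
    then show ?thesis using insert by (simp add: insert_absorb)
  next
    case new: False
    let ?A = "component F a" and ?B = "component F b"
    \<comment> \<open>No edge of \<open>H\<close> is lighter than \<open>e\<close>, so the last
      invariant applies at both ends of \<open>e\<close>.\<close>
    have wA: "y e \<le> w ?A" and wB: "y e \<le> w ?B"
      using w_comp[OF \<open>e \<in> E\<close> new _ le] e by auto
    show ?thesis
    proof (cases "(a, b) \<in> (adjacency F)\<^sup>*")
      case True
      then have "(b, a) \<in> (adjacency F)\<^sup>*"
        using sym_adjacency_rtrancl by (metis symD)
      then have "(adjacency F)\<^sup>* = (adjacency (insert {a, b} F))\<^sup>*"
        using True by (auto simp: adjacency_insert rtrancl_insert intro: rtrancl_trans)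
      then have "(adjacency F)\<^sup>* = (adjacency (insert e H))\<^sup>*"
        using rtrancl_adjacency_insert_cong[OF F(3)] e by simp
      \<comment> \<open>Both ends lie in the component of \<open>a\<close>, whose weight alone
        already covers \<open>y e\<close>.\<close>
      moreover have "y e \<le> sum w {S. e \<subseteq> S}"
      proof -
        have "sum w {?A} \<le> sum w {S. e \<subseteq> S}"
          using True w_nonneg by (intro sum_mono2) (auto simp: e)
        then show ?thesis using wA by simp
      qed
      moreover have "y e' \<le> w (component F v)"
        if "e' \<in> E - insert e H" "v \<in> e'" "\<forall>h\<in>insert e H. y e' \<le> y h" for e' v
        using that by (intro w_comp) auto
      ultimately show ?thesis
        using F w_nonneg w_supp w_node w_edge w_total
        by (intro exI[of _ F] exI[of _ w]) (simp add: subset_insertI2)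
    next
      case sep: False
      let ?U = "?A \<union> ?B"
      define w' where
        "w' = (\<lambda>S. w S + y e * (of_bool (S = ?U) - of_bool (S = ?A) - of_bool (S = ?B)))"
      have disj: "?A \<inter> ?B = {}" using component_disjoint sep by metis
      have ab: "a \<in> ?A" "b \<in> ?B" by auto
      have neq: "?A \<noteq> ?B" "?U \<noteq> ?A" "?U \<noteq> ?B" using disj ab by blast+
      have y0: "0 \<le> y e" using assms(2) \<open>e \<in> E\<close> by simp
      have sum_w': "sum w' X = sum w X + y e * (of_bool (?U \<in> X) - of_bool (?A \<in> X) - of_bool (?B \<in> X))"
        for X unfolding w'_def by (rule sum_move_weight)
      have FE: "\<forall>e\<in>F. e \<subseteq> V"
        using F(1) \<open>H \<subseteq> E\<close> assms(1) by (auto simp: finite_graph_def)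
      have AV: "?A \<subseteq> V" "?B \<subseteq> V"
        using component_subset[OF FE] e by auto
      \<comment> \<open>\<open>?A\<close> and \<open>?B\<close> are distinct, so each loses
        \<open>y e\<close> only once, which \<open>wA\<close> and \<open>wB\<close> permit.\<close>
      have nonneg': "0 \<le> w' S" for S
        using w_nonneg[of S] wA wB y0 neq by (auto simp: w'_def of_bool_def)
      have supp': "S \<noteq> {} \<and> S \<subseteq> V" if "w' S \<noteq> 0" for S
      proof (cases "S = ?U \<or> S = ?A \<or> S = ?B")
        case True
        then show ?thesis using AV ab by blast
      next
        case False
        then show ?thesis using that w_supp by (simp add: w'_def)
      qed
      \<comment> \<open>A node of \<open>?U\<close> lies in exactly one of \<open>?A\<close> and
        \<open>?B\<close>, so gain and loss cancel.\<close>
      have node': "sum w' {S. v \<in> S} = z v" if "v \<in> V" for v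
        using w_node[OF that] disj by (auto simp: sum_w' of_bool_def)
      \<comment> \<open>The edge \<open>e\<close> fits into \<open>?U\<close> only and gains
        \<open>y e\<close>. Any other edge lies in at most one of \<open>?A\<close> and
        \<open>?B\<close>, and then also in \<open>?U\<close>, so it loses nothing.\<close>
      have edge': "y h \<le> sum w' {S. h \<subseteq> S}" if h: "h \<in> insert e H" for h
      proof (cases "h = e")
        case True
        have "\<not> e \<subseteq> ?A" "\<not> e \<subseteq> ?B" "e \<subseteq> ?U" using e disj ab by auto
        then have "sum w' {S. e \<subseteq> S} = sum w {S. e \<subseteq> S} + y e"
          by (simp add: sum_w')
        then show ?thesis using True w_nonneg by (simp add: sum_nonneg)
      next
        case False
        then have "h \<in> H" using h by simp
        then have "h \<noteq> {}" using \<open>H \<subseteq> E\<close> assms(1) by (force simp: finite_graph_def)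
        then have both: "\<not> (h \<subseteq> ?A \<and> h \<subseteq> ?B)" using disj by blast
        have mono: "h \<subseteq> ?A \<or> h \<subseteq> ?B \<longrightarrow> h \<subseteq> ?U" by blast
        have of_bool: "0 \<le> (of_bool R - of_bool P - of_bool Q :: real)"
          if "\<not> (P \<and> Q)" "P \<or> Q \<longrightarrow> R" for P Q R
          using that by auto
        from mult_nonneg_nonneg[OF y0 of_bool[OF both mono]]
        have "sum w {S. h \<subseteq> S} \<le> sum w' {S. h \<subseteq> S}"
          unfolding sum_w' mem_Collect_eq by linarith
        then show ?thesis using w_edge[OF \<open>h \<in> H\<close>] by simp
      qed
      have "e \<notin> F" using F(1) new by auto
      then have total': "sum w' UNIV = sum z V - sum y (insert e F)"
        using w_total by (simp add: sum_w')
      \<comment> \<open>The order of insertion matters here: the merged component has weight at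
        least \<open>y e\<close>, which is at least \<open>y e'\<close>. Other components keep their
        weight.\<close>
      have comp': "y e' \<le> w' (component (insert e F) v)"
        if e': "e' \<in> E - insert e H" "v \<in> e'" "\<forall>h\<in>insert e H. y e' \<le> y h" for e' v
      proof (cases "v \<in> ?U")
        case True
        then have "component (insert e F) v = ?U" by (simp add: component_insert e)
        then show ?thesis
          using e'(3) neq w_nonneg[of ?U] by (simp add: w'_def)
      next
        case False
        then have "component (insert e F) v = component F v"
          unfolding e(1) component_insert by meson
        moreover have "v \<in> component F v" by simp
        then have "component F v \<noteq> ?U" "component F v \<noteq> ?A" "component F v \<noteq> ?B"
          using False by blast+
        moreover have "y e' \<le> w (component F v)"
          using e' by (intro w_comp) auto
        ultimately show ?thesis by (simp add: w'_def)
      qed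
      have "\<not> is_cycle (insert e F) vs" for vs
        using is_cycle_insert_edge[of a b F vs] F(2) sep sym_adjacency_rtrancl[of F] e(1)
        by (metis symD)
      moreover have "(adjacency (insert e F))\<^sup>* = (adjacency (insert e H))\<^sup>*"
        using rtrancl_adjacency_insert_cong[OF F(3)] e(1) by simp
      moreover have "insert e F \<subseteq> insert e H" using F(1) by blast
      ultimately show ?thesis
        using nonneg' supp' node' edge' total' comp'
        by (intro exI[of _ "insert e F"] exI[of _ w']) simp
    qed
  qed
qed

subsection \<open>The polytopes\<close>

text \<open>The unit cube is the hull of its 0/1 points. The projection \<open>p\<close> onto the
  coordinates in \<open>A\<close> fixes \<open>x\<close> and sends those points to characteristic
  vectors of subsets of \<open>A\<close>.\<close>

lemma cube_subset_convex_hull_char_vec: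
  fixes x :: "real ^ 'i::finite"
  assumes "\<And>i. 0 \<le> x $ i" "\<And>i. x $ i \<le> 1" "\<And>i. i \<notin> A \<Longrightarrow> x $ i = 0"
  shows "x \<in> convex hull {char_vec F | F. F \<subseteq> A}"
proof -
  define p where "p = (\<lambda>x::real ^ 'i. (\<chi> i. if i \<in> A then x $ i else 0) :: real ^ 'i)"
  let ?X = "{x :: real ^ 'i. \<forall>i\<in>Basis. x \<bullet> i = 0 \<or> x \<bullet> i = 1}"
  have "linear p"
    by (rule linearI) (auto simp: p_def vec_eq_iff)
  have "0 \<le> x \<bullet> b \<and> x \<bullet> b \<le> 1" if "b \<in> Basis" for b
    using that assms(1,2) by (auto simp: Basis_vec_def inner_axis)
  then have "x \<in> cbox 0 One"
    by (simp add: mem_box)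
  then have "p x \<in> p ` (convex hull ?X)"
    by (simp add: unit_interval_convex_hull)
  also have "\<dots> = convex hull (p ` ?X)"
    using convex_hull_linear_image[OF \<open>linear p\<close>] by simp
  also have "\<dots> \<subseteq> convex hull {char_vec F | F. F \<subseteq> A}"
  proof (rule hull_mono, clarify)
    fix u :: "real ^ 'i" assume u: "\<forall>i\<in>Basis. u \<bullet> i = 0 \<or> u \<bullet> i = 1"
    have "u $ i = 0 \<or> u $ i = 1" for i
      using bspec[OF u, of "axis i 1"] by (simp add: inner_axis)
    then have "p u = char_vec {i \<in> A. u $ i = 1}"
      by (auto simp: p_def char_vec_def vec_eq_iff indicator_def)
    then show "\<exists>F. p u = char_vec F \<and> F \<subseteq> A" by blast
  qed
  also have "p x = x"
    using assms(3) by (simp add: p_def vec_eq_iff)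
  finally show ?thesis .
qed

lemma subgraph_polytope_bounds:
  assumes "(y, z) \<in> subgraph_polytope V E"
  shows "(y, z) \<in> edge_node_space V E"
    and "0 \<le> y $ e" and "0 \<le> z $ v" and "e \<in> E \<Longrightarrow> v \<in> e \<Longrightarrow> y $ e \<le> z $ v"
proof -
  let ?Q = "{p. p \<in> edge_node_space V E \<and> (\<forall>e. 0 \<le> fst p $ e) \<and> (\<forall>v. 0 \<le> snd p $ v) \<and>
      (\<forall>e\<in>E. \<forall>v\<in>e. fst p $ e \<le> snd p $ v)}"
  have "convex ?Q"
    by (rule convexI) (auto simp: edge_node_space_def intro!: add_mono mult_left_mono)
  moreover have "{(char_vec F, char_vec S) | F S. F \<subseteq> edges_within E S \<and> S \<subseteq> V} \<subseteq> ?Q"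
    by (auto simp: edge_node_space_def char_vec_def edges_within_def indicator_def) blast
  ultimately have "subgraph_polytope V E \<subseteq> ?Q"
    unfolding subgraph_polytope_def by (rule hull_minimal[rotated])
  then have "(y, z) \<in> ?Q" using assms by blast
  then show "(y, z) \<in> edge_node_space V E" "0 \<le> y $ e" "0 \<le> z $ v"
    and "e \<in> E \<Longrightarrow> v \<in> e \<Longrightarrow> y $ e \<le> z $ v"
    by auto
qed

text \<open>The half-space is convex, so generators suffice. For
  \<open>(char_vec D, char_vec S)\<close> the bound says that the forest \<open>F \<inter> D\<close>
  on the nonempty set \<open>S\<close> has fewer than \<open>card S\<close> edges.\<close>

lemma nonempty_subgraph_polytope_forest_bound:
  fixes V :: "'v::finite set"
  assumes "finite_graph V E" "(y, z) \<in> nonempty_subgraph_polytope V E"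
    and "F \<subseteq> E" "\<nexists>vs. is_cycle F vs"
  shows "(\<Sum>e\<in>F. y $ e) \<le> (\<Sum>v\<in>V. z $ v) - 1"
proof -
  let ?Q = "{p. (\<Sum>e\<in>F. fst p $ e) \<le> (\<Sum>v\<in>V. snd p $ v) - (1 :: real)}"
  have "convex ?Q"
  proof (rule convexI)
    fix p q :: "(real ^ ('v set)) \<times> (real ^ 'v)" and s t :: real
    assume pq: "p \<in> ?Q" "q \<in> ?Q" and st: "0 \<le> s" "0 \<le> t" "s + t = 1"
    have "s * (\<Sum>e\<in>F. fst p $ e) + t * (\<Sum>e\<in>F. fst q $ e)
        \<le> s * ((\<Sum>v\<in>V. snd p $ v) - 1) + t * ((\<Sum>v\<in>V. snd q $ v) - 1)"
      using pq st by (intro add_mono mult_left_mono) auto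
    also have "\<dots> = s * (\<Sum>v\<in>V. snd p $ v) + t * (\<Sum>v\<in>V. snd q $ v) - 1"
      using st by (simp add: algebra_simps)
    finally show "s *\<^sub>R p + t *\<^sub>R q \<in> ?Q"
      by (simp add: sum.distrib sum_distrib_left)
  qed
  have bound: "(\<Sum>e\<in>F. char_vec D $ e) \<le> (\<Sum>v\<in>V. char_vec S $ v) - (1::real)"
    if DS: "D \<subseteq> edges_within E S" "S \<noteq> {}" "S \<subseteq> V" for D S
  proof -
    have "card (F \<inter> D) < card S"
    proof (rule forest_card_edges_less)
      show "\<forall>e\<in>F \<inter> D. e \<subseteq> S \<and> card e = 2"
        using DS assms(1) by (auto simp: finite_graph_def edges_within_def)
      show "\<nexists>vs. is_cycle (F \<inter> D) vs"
        using assms(4) is_cycle_mono[of "F \<inter> D" _ F] by blast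
    qed (use DS in auto)
    moreover have "V \<inter> S = S" using DS by blast
    ultimately show ?thesis
      by (simp add: char_vec_def indicator_def sum.If_cases)
  qed
  have "{(char_vec D, char_vec S) | D S. D \<subseteq> edges_within E S \<and> S \<noteq> {} \<and> S \<subseteq> V} \<subseteq> ?Q"
  proof
    fix g assume "g \<in> {(char_vec D, char_vec S) | D S. D \<subseteq> edges_within E S \<and> S \<noteq> {} \<and> S \<subseteq> V}"
    then obtain D S where "g = (char_vec D, char_vec S)" "D \<subseteq> edges_within E S" "S \<noteq> {}" "S \<subseteq> V"
      by blast
    then show "g \<in> ?Q" using bound[of D S] by simp
  qed
  from hull_minimal[of _ _ convex, OF this \<open>convex ?Q\<close>]
  have "nonempty_subgraph_polytope V E \<subseteq> ?Q"
    unfolding nonempty_subgraph_polytope_def .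
  then show ?thesis using assms(2) by auto
qed

text \<open>The only extra generator of the larger polytope is the origin, since no edge fits into
  the empty set. Adjoining one point to a nonempty hull yields the segments from that point.\<close>

lemma subgraph_polytope_scaled:
  assumes "finite_graph V E" "p \<in> subgraph_polytope V E" "V \<noteq> {}"
  obtains u q where "0 \<le> u" "u \<le> 1" "q \<in> nonempty_subgraph_polytope V E" "p = u *\<^sub>R q"
proof -
  let ?G = "{(char_vec F, char_vec S) | F S. F \<subseteq> edges_within E S \<and> S \<noteq> {} \<and> S \<subseteq> V}"
  have "(char_vec {}, char_vec V) \<in> ?G" using assms(3) by blast
  then have "?G \<noteq> {}" by blast
  have zero: "char_vec {} = (0 :: real ^ 'i::finite)" by (simp add: char_vec_def vec_eq_iff)
  have "{(char_vec F, char_vec S) | F S. F \<subseteq> edges_within E S \<and> S \<subseteq> V} \<subseteq> insert 0 ?G"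
  proof
    fix g assume "g \<in> {(char_vec F, char_vec S) | F S. F \<subseteq> edges_within E S \<and> S \<subseteq> V}"
    then obtain F S where g: "g = (char_vec F, char_vec S)" "F \<subseteq> edges_within E S" "S \<subseteq> V"
      by blast
    show "g \<in> insert 0 ?G"
    proof (cases "S = {}")
      case True
      then have "F = {}"
        using g assms(1) by (force simp: edges_within_def finite_graph_def)
      then show ?thesis using g True by (simp add: zero zero_prod_def)
    qed (use g in blast)
  qed
  then have "p \<in> convex hull (insert 0 ?G)"
    using assms(2) hull_mono unfolding subgraph_polytope_def by blast
  then show thesis
    unfolding convex_hull_insert[OF \<open>?G \<noteq> {}\<close>] nonempty_subgraph_polytope_def[symmetric]
    using that by auto
qed

text \<open>The weights divided by \<open>T\<close> are the coefficients of a convex combination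
  with one point \<open>(x S, char_vec S)\<close> for each node set \<open>S\<close>.\<close>

lemma nonempty_subgraph_polytope_weights:
  fixes V :: "'v::finite set" and w :: "'v set \<Rightarrow> real"
  assumes "(y, z) \<in> edge_node_space V E"
    and y0: "\<And>e. 0 \<le> y $ e"
    and w0: "\<And>S. 0 \<le> w S" and supp: "\<And>S. w S \<noteq> 0 \<Longrightarrow> S \<noteq> {} \<and> S \<subseteq> V"
    and node: "\<And>v. v \<in> V \<Longrightarrow> sum w {S. v \<in> S} = z $ v"
    and edge: "\<And>e. e \<in> E \<Longrightarrow> y $ e \<le> sum w {S. e \<subseteq> S}"
    and total: "sum w UNIV = T" "0 < T"
  shows "(1 / T) *\<^sub>R (y, z) \<in> nonempty_subgraph_polytope V E"
proof -
  \<comment> \<open>Only sets of nonzero weight are known to be nonempty subsets of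
    \<open>V\<close>, so the combination ranges over these.\<close>
  define W where "W = {S. w S \<noteq> 0}"
  have sum_W: "sum f UNIV = sum f W" if "\<And>S. w S = 0 \<Longrightarrow> f S = 0" for f :: "'v set \<Rightarrow> real"
    using that by (intro sum.mono_neutral_right) (auto simp: W_def)
  \<comment> \<open>distributes \<open>y\<close> proportionally over the node sets; \<open>0 / 0 = 0\<close> is the right value here\<close>
  define x where
    "x = (\<lambda>S. (\<chi> e. if e \<in> E \<and> e \<subseteq> S then y $ e / sum w {S. e \<subseteq> S} else 0) :: real ^ ('v set))"
  have "(\<Sum>S\<in>W. (w S / T) *\<^sub>R (x S, char_vec S)) \<in> nonempty_subgraph_polytope V E"
  proof (rule convex_sum)
    show "convex (nonempty_subgraph_polytope V E)"
      by (simp add: nonempty_subgraph_polytope_def)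
    show "(\<Sum>S\<in>W. w S / T) = 1"
      using sum_W[of w] total by (simp flip: sum_divide_distrib)
    fix S assume "S \<in> W"
    then have S: "S \<noteq> {}" "S \<subseteq> V" using supp by (auto simp: W_def)
    have "x S \<in> convex hull {char_vec F | F. F \<subseteq> edges_within E S}"
    proof (rule cube_subset_convex_hull_char_vec)
      fix e
      have "0 \<le> sum w {S. e \<subseteq> S}" using w0 by (simp add: sum_nonneg)
      then show "0 \<le> x S $ e" "x S $ e \<le> 1"
        using y0[of e] edge[of e] by (auto simp: x_def divide_le_eq_1)
    qed (auto simp: x_def edges_within_def)
    then have "(x S, char_vec S) \<in> convex hull ({char_vec F | F. F \<subseteq> edges_within E S} \<times> {char_vec S})"
      by (simp add: convex_hull_Times)
    also have "\<dots> \<subseteq> nonempty_subgraph_polytope V E"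
      unfolding nonempty_subgraph_polytope_def using S by (intro hull_mono) auto
    finally show "(x S, char_vec S) \<in> nonempty_subgraph_polytope V E" .
  qed (use w0 total in auto)
  also have "(\<Sum>S\<in>W. (w S / T) *\<^sub>R (x S, char_vec S)) = (1 / T) *\<^sub>R (y, z)"
  proof (rule prod_eqI)
    have "(\<Sum>S\<in>W. w S / T * x S $ e) = y $ e / T" for e
    proof (cases "e \<in> E")
      case True
      have "(\<Sum>S\<in>W. w S / T * x S $ e) = (\<Sum>S\<in>UNIV. w S / T * x S $ e)"
        by (rule sum_W[symmetric]) simp
      also have "\<dots> = (\<Sum>S\<in>{S. e \<subseteq> S}. w S * (y $ e / sum w {S. e \<subseteq> S} / T))"
        using True by (intro sum.mono_neutral_cong_right) (auto simp: x_def)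
      also have "\<dots> = sum w {S. e \<subseteq> S} * (y $ e / sum w {S. e \<subseteq> S} / T)"
        by (rule sum_distrib_right[symmetric])
      \<comment> \<open>If the denominator vanishes, then \<open>edge\<close> and \<open>y0\<close>
        force \<open>y $ e = 0\<close>.\<close>
      also have "\<dots> = y $ e / T"
        using edge[OF True] y0[of e] by auto
      finally show ?thesis .
    next
      case False
      then show ?thesis using assms(1) by (simp add: x_def edge_node_space_def)
    qed
    then show "fst (\<Sum>S\<in>W. (w S / T) *\<^sub>R (x S, char_vec S)) = fst ((1 / T) *\<^sub>R (y, z))"
      by (simp add: fst_sum vec_eq_iff)
    have "(\<Sum>S\<in>W. w S / T * char_vec S $ v) = z $ v / T" for v
    proof (cases "v \<in> V")
      case True
      have "(\<Sum>S\<in>W. w S / T * char_vec S $ v) = (\<Sum>S\<in>UNIV. w S / T * char_vec S $ v)"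
        by (rule sum_W[symmetric]) simp
      also have "\<dots> = (\<Sum>S\<in>{S. v \<in> S}. w S / T)"
        by (intro sum.mono_neutral_cong_right) (auto simp: char_vec_def)
      also have "\<dots> = z $ v / T"
        using node[OF True] by (simp flip: sum_divide_distrib)
      finally show ?thesis .
    next
      case False
      then have "w S / T * char_vec S $ v = 0" for S
        using supp[of S] by (auto simp: char_vec_def indicator_def)
      then have "(\<Sum>S\<in>W. w S / T * char_vec S $ v) = 0"
        by (rule sum.neutral[OF ballI])
      then show ?thesis
        using False assms(1) by (simp add: edge_node_space_def)
    qed
    then show "snd (\<Sum>S\<in>W. (w S / T) *\<^sub>R (x S, char_vec S)) = snd ((1 / T) *\<^sub>R (y, z))"
      by (simp add: snd_sum vec_eq_iff)
  qed
  finally show ?thesis .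
qed

text \<open>On the ray through \<open>q\<close>, the three points have parameters
  \<open>u / T\<close>, \<open>u\<close> and \<open>1\<close>, in this order.\<close>

lemma convex_scaled_between:
  fixes p q :: "'a::real_vector"
  assumes "convex K" "q \<in> K" "p = u *\<^sub>R q" "0 < u" "u \<le> 1" "(1 / T) *\<^sub>R p \<in> K" "1 \<le> T"
  shows "p \<in> K"
\<comment> \<open>For \<open>T = 1\<close> the scaled point is \<open>p\<close> itself; otherwise
  \<open>T - u\<close> is positive and may be divided by.\<close>
proof (cases "T = 1")
  case False
  then have T: "1 < T" using assms(7) by simp
  \<comment> \<open>This is the solution of \<open>r + (1 - r) * u / T = u\<close>.\<close>
  define r where "r = (T - 1) * u / (T - u)"
  have pos: "0 < T - u" using T assms(5) by simp
  have "0 \<le> r" using T assms pos by (simp add: r_def)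
  moreover have "1 - r = T * (1 - u) / (T - u)"
    using pos by (simp add: r_def field_simps)
  moreover have "0 \<le> T * (1 - u) / (T - u)" using T assms pos by simp
  ultimately have "r *\<^sub>R q + (1 - r) *\<^sub>R ((1 / T) *\<^sub>R p) \<in> K"
    using assms by (intro convexD) auto
  also have "r *\<^sub>R q + (1 - r) *\<^sub>R ((1 / T) *\<^sub>R p) = (r + (1 - r) * u / T) *\<^sub>R q"
    using assms(3) by (simp add: algebra_simps)
  also have "r + (1 - r) * u / T = u"
  proof -
    have "(1 - r) * u / T = (1 - u) * u / (T - u)"
      unfolding \<open>1 - r = _\<close> using T by simp
    then show ?thesis
      using pos by (simp add: r_def field_simps)
  qed
  finally show ?thesis using assms(3) by simp
qed (use assms in simp)

theorem theorem2:
  fixes V :: "'v::finite set" and E :: "'v set set"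
  assumes "finite_graph V E"
  shows "nonempty_subgraph_polytope V E =
    subgraph_polytope V E \<inter>
      {(y, z) \<in> edge_node_space V E.
        \<forall>F. spanning_forest V E F \<longrightarrow> (\<Sum>e\<in>F. y $ e) \<le> (\<Sum>v\<in>V. z $ v) - 1}"
  (is "?P = ?R")
proof (intro equalityI subsetI)
  fix p assume p: "p \<in> ?P"
  obtain y z where yz: "p = (y, z)" by fastforce
  have "?P \<subseteq> subgraph_polytope V E"
    unfolding nonempty_subgraph_polytope_def subgraph_polytope_def by (intro hull_mono) blast
  then have sub: "(y, z) \<in> subgraph_polytope V E" using p yz by blast
  have "(\<Sum>e\<in>F. y $ e) \<le> (\<Sum>v\<in>V. z $ v) - 1" if "spanning_forest V E F" for F
    using nonempty_subgraph_polytope_forest_bound[OF assms p[unfolded yz]] that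
    unfolding spanning_forest_def by blast
  then show "p \<in> ?R"
    using sub subgraph_polytope_bounds(1)[OF sub] yz by simp
next
  fix p assume p: "p \<in> ?R"
  obtain y z where yz: "p = (y, z)" by fastforce
  have sub: "(y, z) \<in> subgraph_polytope V E" and space: "(y, z) \<in> edge_node_space V E"
    and forest: "\<And>F. spanning_forest V E F \<Longrightarrow> (\<Sum>e\<in>F. y $ e) \<le> (\<Sum>v\<in>V. z $ v) - 1"
    using p yz by auto
  note bounds = subgraph_polytope_bounds[OF sub]
  have le: "\<forall>e\<in>E. \<forall>v\<in>e. y $ e \<le> z $ v" using bounds(4) by blast
  obtain F w where F: "F \<subseteq> E" "\<nexists>vs. is_cycle F vs" "(adjacency F)\<^sup>* = (adjacency E)\<^sup>*"
    and w: "\<forall>S. 0 \<le> w S" "\<forall>S. w S \<noteq> 0 \<longrightarrow> S \<noteq> {} \<and> S \<subseteq> V"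
      "\<forall>v\<in>V. sum w {S. v \<in> S} = z $ v" "\<forall>e\<in>E. y $ e \<le> sum w {S. e \<subseteq> S}"
    and total: "sum w UNIV = (\<Sum>v\<in>V. z $ v) - (\<Sum>e\<in>F. y $ e)"
    using kruskal_weights[OF assms, of "\<lambda>e. y $ e" "\<lambda>v. z $ v", OF bounds(2,3) le order_refl]
    by (elim exE conjE) (rule that; assumption)
  have "spanning_forest V E F"
    unfolding spanning_forest_def using F(1,2) connected_components_cong[OF F(3)] by blast
  \<comment> \<open>The constraint of this one forest is exactly the bound on the total
    weight.\<close>
  from forest[OF this] have T: "1 \<le> sum w UNIV" using total by linarith
  then have scaled: "(1 / sum w UNIV) *\<^sub>R (y, z) \<in> ?P"
    using nonempty_subgraph_polytope_weights[OF space bounds(2) w[rule_format] refl] by linarith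
  \<comment> \<open>Positivity of \<open>z\<close> summed over \<open>V\<close> rules out both an
    empty \<open>V\<close> and the factor \<open>u = 0\<close>.\<close>
  have "0 \<le> (\<Sum>e\<in>F. y $ e)" by (simp add: sum_nonneg bounds(2))
  then have z_pos: "0 < (\<Sum>v\<in>V. z $ v)" using T total by simp
  then have "V \<noteq> {}" by auto
  then obtain u q where q: "0 \<le> u" "u \<le> 1" "q \<in> ?P" "(y, z) = u *\<^sub>R q"
    using subgraph_polytope_scaled[OF assms sub] by blast
  have "u \<noteq> 0"
    using q(4) z_pos by (auto simp: zero_prod_def)
  then have "0 < u" using q(1) by simp
  have "convex ?P" by (simp add: nonempty_subgraph_polytope_def)
  from convex_scaled_between[OF this q(3,4) \<open>0 < u\<close> q(2) scaled T] have "(y, z) \<in> ?P" .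
  then show "p \<in> ?P" using yz by simp
qed

end
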